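(* Let $l\geq 1$ be an integer, let $\omega\in\mathbb{R}$ and let $x_n=x_n(\omega)=\operatorname{tr}(T_n(\omega))$ be the traces of the transfer matrices of the generalised metal mean Fibonacci tiling (parameters $m=1$ and $l$), so that they satisfy the recursion relation $$x_{n+1}=d_l(x_{n-1})\left[x_n x_{n-1}-d_{l+1}(x_{n-2})+d_{l-1}(x_{n-2})\right]-x_n d_{l-1}(x_{n-1}),\qquad n\geq 2.$$ Suppose that there exists some $N\in\mathbb{N}$ such that $$|x_N|>2,\qquad |x_{N+1}|\geq \frac{5}{2}\qquad\text{and}\qquad |x_{N+2}|\geq \max\{|x_{N+1}|,\,|d_{l+1}(x_N)|\}.$$ Then $|x_n|>2$ for all $n\geq N$, meaning that $\omega$ is in the super band gap $\mathcal{S}_N$.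
   Context: The polynomials $d_k(x)$ are defined by $d_0(x)=0$, $d_1(x)=1$ and $d_k(x)=x\,d_{k-1}(x)-d_{k-2}(x)$ for $k\geq 2$. Generalised Fibonacci tilings with parameters $m,l\ge 1$ (positive integers) are words $\mathcal{F}_n$ in two letters $A,B$ generated by the substitution $A\to A^mB^l$, $B\to A$, starting from $\mathcal{F}_0=B$, $\mathcal{F}_1=A$. To each frequency $\omega$ are associated transfer matrices $T_n(\omega)\in\mathbb{R}^{2\times 2}$ with $\det T_n(\omega)=1$, where $T_0$ is the transfer matrix of the element $B$, $T_1$ that of the element $A$, and $T_{n+1}=T_{n-1}^{\,l}\,T_n^{\,m}$ for $n\geq 1$. The super band gap is $\mathcal{S}_N:=\{\omega\in\mathbb{R}: |x_n(\omega)|>2 \text{ for all } n\geq N\}$, where $x_n(\omega)=\operatorname{tr}(T_n(\omega))$. *)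

theory Defs
  imports "HOL-Analysis.Analysis"
begin

fun d :: "nat \<Rightarrow> real \<Rightarrow> real" where
  "d 0 x = 0"
| "d (Suc 0) x = 1"
| "d (Suc (Suc k)) x = x * d (Suc k) x - d k x"

datatype letter = A | B

fun subst_letter :: "nat \<Rightarrow> nat \<Rightarrow> letter \<Rightarrow> letter list" where
  "subst_letter m l A = replicate m A @ replicate l B"
| "subst_letter m l B = [A]"

definition subst_word :: "nat \<Rightarrow> nat \<Rightarrow> letter list \<Rightarrow> letter list" where
  "subst_word m l w = concat (map (subst_letter m l) w)"

fun tiling :: "nat \<Rightarrow> nat \<Rightarrow> nat \<Rightarrow> letter list" where
  "tiling m l 0 = [B]"
| "tiling m l (Suc n) = subst_word m l (tiling m l n)"

(* The power operation of the type class on real^2^2 is componentwise, hence this one. *)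
definition matpow :: "real^2^2 \<Rightarrow> nat \<Rightarrow> real^2^2" where
  "matpow M k = (((**) M) ^^ k) (mat 1)"

(* T0 and T1 give the transfer matrices of the elements B and A, as functions of the frequency. *)
fun transfer :: "(real \<Rightarrow> real^2^2) \<Rightarrow> (real \<Rightarrow> real^2^2) \<Rightarrow> nat \<Rightarrow> nat \<Rightarrow> nat \<Rightarrow> real \<Rightarrow> real^2^2"
where
  "transfer T0 T1 m l 0 \<omega> = T0 \<omega>"
| "transfer T0 T1 m l (Suc 0) \<omega> = T1 \<omega>"
| "transfer T0 T1 m l (Suc (Suc n)) \<omega> =
     matpow (transfer T0 T1 m l n \<omega>) l ** matpow (transfer T0 T1 m l (Suc n) \<omega>) m"

definition transfer_trace ::
  "(real \<Rightarrow> real^2^2) \<Rightarrow> (real \<Rightarrow> real^2^2) \<Rightarrow> nat \<Rightarrow> nat \<Rightarrow> nat \<Rightarrow> real \<Rightarrow> real" where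
  "transfer_trace T0 T1 m l n \<omega> = trace (transfer T0 T1 m l n \<omega>)"

definition super_band_gap ::
  "(real \<Rightarrow> real^2^2) \<Rightarrow> (real \<Rightarrow> real^2^2) \<Rightarrow> nat \<Rightarrow> nat \<Rightarrow> nat \<Rightarrow> real set" where
  "super_band_gap T0 T1 m l N = {\<omega>. \<forall>n\<ge>N. \<bar>transfer_trace T0 T1 m l n \<omega>\<bar> > 2}"

lemma matpow_0 [simp]: "matpow M 0 = mat 1"
  by (simp add: matpow_def)

lemma matpow_Suc [simp]: "matpow M (Suc k) = M ** matpow M k"
  by (simp add: matpow_def)

lemma matpow_1 [simp]: "matpow M (Suc 0) = M"
  by simp

lemma matpow_Suc_right: "matpow M k ** M = M ** matpow M k"
  by (induction k) (simp_all flip: matrix_mul_assoc)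

(* The transfer matrix of a finite word: a wave passing through the word from left to right
   meets its first letter first, so the matrices of later letters multiply on the left. *)
fun word_transfer :: "(real \<Rightarrow> real^2^2) \<Rightarrow> (real \<Rightarrow> real^2^2) \<Rightarrow> letter list \<Rightarrow> real \<Rightarrow> real^2^2"
where
  "word_transfer T0 T1 [] \<omega> = mat 1"
| "word_transfer T0 T1 (c # w) \<omega> =
     word_transfer T0 T1 w \<omega> ** (case c of A \<Rightarrow> T1 \<omega> | B \<Rightarrow> T0 \<omega>)"

lemma subst_word_append: "subst_word m l (v @ w) = subst_word m l v @ subst_word m l w"
  by (simp add: subst_word_def)

lemma subst_word_concat_replicate:
  "subst_word m l (concat (replicate k w)) = concat (replicate k (subst_word m l w))"
  by (induction k) (simp_all add: subst_word_append, simp add: subst_word_def)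

lemma concat_replicate_single: "concat (replicate k [x]) = replicate k x"
  by (induction k) simp_all

lemma tiling_rec:
  "tiling m l (Suc (Suc n)) =
     concat (replicate m (tiling m l (Suc n))) @ concat (replicate l (tiling m l n))"
proof (induction n)
  case 0
  show ?case by (simp add: subst_word_def concat_replicate_single)
next
  case (Suc n)
  have "tiling m l (Suc (Suc (Suc n))) = subst_word m l (tiling m l (Suc (Suc n)))"
    by (rule tiling.simps)
  also have "\<dots> = concat (replicate m (subst_word m l (tiling m l (Suc n))))
                   @ concat (replicate l (subst_word m l (tiling m l n)))"
    by (simp only: Suc.IH subst_word_append subst_word_concat_replicate)
  finally show ?case by (simp only: tiling.simps)
qed

lemma word_transfer_append:
  "word_transfer T0 T1 (v @ w) \<omega> = word_transfer T0 T1 w \<omega> ** word_transfer T0 T1 v \<omega>"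
  by (induction v) (simp_all add: matrix_mul_assoc)

lemma word_transfer_concat_replicate:
  "word_transfer T0 T1 (concat (replicate k w)) \<omega> = matpow (word_transfer T0 T1 w \<omega>) k"
  by (induction k) (simp_all add: word_transfer_append matpow_Suc_right)

lemma transfer_eq_word_transfer:
  "transfer T0 T1 m l n \<omega> = word_transfer T0 T1 (tiling m l n) \<omega>"
proof (induction n rule: induct_nat_012)
  case (ge2 n)
  then show ?case
    by (simp only: transfer.simps tiling_rec word_transfer_append word_transfer_concat_replicate)
qed (simp_all add: subst_word_def)

lemma mat2_eq_iff: "(M :: real^2^2) = K \<longleftrightarrow>
    M $ 1 $ 1 = K $ 1 $ 1 \<and> M $ 1 $ 2 = K $ 1 $ 2 \<and> M $ 2 $ 1 = K $ 2 $ 1 \<and> M $ 2 $ 2 = K $ 2 $ 2"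
  by (auto simp: vec_eq_iff forall_2)

lemmas mat2_simps = mat2_eq_iff matrix_matrix_mult_def sum_2 mat_def trace_def

lemma cayley_hamilton_2:
  assumes "det (M :: real^2^2) = 1"
  shows "M ** M = trace M *\<^sub>R M - mat 1"
proof -
  have "M $ 1 $ 1 * M $ 2 $ 2 - M $ 1 $ 2 * M $ 2 $ 1 = 1"
    using assms by (simp only: det_2)
  then show ?thesis
    by (simp only: mat2_simps) (simp, algebra)
qed

lemma matpow_eq_d:
  assumes "det M = 1"
  shows "matpow M (Suc k) = d (Suc k) (trace M) *\<^sub>R M - d k (trace M) *\<^sub>R mat 1"
proof (induction k)
  case (Suc k)
  have "matpow M (Suc (Suc k)) = d (Suc k) (trace M) *\<^sub>R (M ** M) - d k (trace M) *\<^sub>R M"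
    unfolding matpow_Suc[of M "Suc k"] Suc.IH by (simp add: mat2_simps algebra_simps)
  then show ?case
    by (simp add: cayley_hamilton_2[OF assms] algebra_simps)
qed simp

lemma det_matpow: "det M = 1 \<Longrightarrow> det (matpow M k) = 1"
  by (induction k) (simp_all add: det_mul)

lemma det_transfer:
  assumes "det (T0 \<omega>) = 1" and "det (T1 \<omega>) = 1"
  shows "det (transfer T0 T1 m l n \<omega>) = 1"
  using assms by (induction n rule: induct_nat_012) (simp_all add: det_mul det_matpow)

lemma trace_lin_mult:
  "trace ((a *\<^sub>R M - b *\<^sub>R mat 1) ** (K :: real^2^2)) = a * trace (M ** K) - b * trace K"
  by (simp add: mat2_simps algebra_simps)

lemma trace_lin: "trace (a *\<^sub>R (M :: real^2^2) - b *\<^sub>R mat 1) = a * trace M - 2 * b"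
  by (simp add: mat2_simps algebra_simps)

lemma trace_mult_lin:
  "trace ((K :: real^2^2) ** (a *\<^sub>R M - mat 1)) = a * trace (K ** M) - trace K"
  by (simp add: mat2_simps algebra_simps)

lemma transfer_trace_recursion:
  fixes T0 T1 :: "real \<Rightarrow> real^2^2" and l n :: nat and \<omega> :: real
  defines "x \<equiv> \<lambda>n. transfer_trace T0 T1 1 l n \<omega>"
  assumes l: "l \<ge> 1" and det: "det (T0 \<omega>) = 1" "det (T1 \<omega>) = 1" and n: "n \<ge> 2"
  shows "x (n + 1) = d l (x (n - 1)) * (x n * x (n - 1) - d (l + 1) (x (n - 2)) + d (l - 1) (x (n - 2)))
                       - x n * d (l - 1) (x (n - 1))"
proof -
  define j where "j = n - 2"
  with n have j: "n = Suc (Suc j)"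
    by simp
  obtain k where k: "l = Suc k"
    using l by (cases l) auto
  define P where "P = transfer T0 T1 1 l j \<omega>"
  define Q where "Q = transfer T0 T1 1 l (Suc j) \<omega>"
  define R where "R = transfer T0 T1 1 l (Suc (Suc j)) \<omega>"
  have det1: "det P = 1" "det Q = 1"
    unfolding P_def Q_def by (intro det_transfer det)+
  have R: "R = matpow P l ** Q"
    by (simp add: P_def Q_def R_def)
  have x: "x (n + 1) = trace (matpow Q l ** R)" "x n = trace R" "x (n - 1) = trace Q" "x (n - 2) = trace P"
    by (simp_all add: x_def transfer_trace_def j P_def Q_def R_def)
  have "trace (matpow Q l ** R) = d (Suc k) (trace Q) * trace (Q ** R) - d k (trace Q) * trace R"
    by (simp only: k matpow_eq_d[OF det1(2)] trace_lin_mult)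
  moreover have "trace (Q ** R) = trace (matpow P l ** (Q ** Q))"
    unfolding R by (subst trace_mul_sym) (simp only: matrix_mul_assoc)
  moreover have "\<dots> = trace Q * trace R - trace (matpow P l)"
    by (simp only: R cayley_hamilton_2[OF det1(2)] trace_mult_lin)
  moreover have "trace (matpow P l) = d (Suc (Suc k)) (trace P) - d k (trace P)"
    by (simp add: k matpow_eq_d[OF det1(1)] trace_lin del: matpow_Suc)
  ultimately have "trace (matpow Q l ** R) =
      d (Suc k) (trace Q) * (trace R * trace Q - d (Suc (Suc k)) (trace P) + d k (trace P))
      - trace R * d k (trace Q)"
    by (simp only: algebra_simps)
  then show ?thesis
    unfolding x by (simp only: k Suc_eq_plus1 [symmetric] diff_Suc_1)
qed

end

theory Submission
  imports Defs
begin

text \<open>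
  Three consecutive traces \<open>a, b, c\<close> determine the next one, and since \<open>d\<close> satisfies its own
  three-term recursion, the trace recursion regroups as
  \<open>e = c * d (l + 1) b - d l b * (d (l + 1) a - d (l - 1) a)\<close>.
  The claim is that the hypothesis reproduces itself when \<open>a, b, c\<close> is replaced by \<open>b, c, e\<close>; then
  all later traces have modulus at least \<open>5 / 2\<close>.

  Outside the interval from \<open>-2\<close> to \<open>2\<close> the values \<open>d (l + 1) a\<close> and \<open>d (l - 1) a\<close> have the same
  sign and the former dominates, so their difference is at most \<open>\<bar>d (l + 1) a\<bar> \<le> \<bar>c\<bar>\<close> in modulus
  and \<open>\<bar>e\<bar> \<ge> \<bar>c\<bar> * (\<bar>d (l + 1) b\<bar> - \<bar>d l b\<bar>)\<close>. The threshold \<open>5 / 2 = 2 + 1 / 2\<close> is the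
  point beyond which \<open>\<bar>d k b\<bar>\<close> at least doubles with each step of \<open>k\<close>. Hence the bracket is at
  least both \<open>\<bar>d l b\<bar> \<ge> 1\<close>, which gives \<open>\<bar>e\<bar> \<ge> \<bar>c\<bar>\<close>, and \<open>\<bar>d (l + 1) b\<bar> / 2\<close>, which gives
  \<open>\<bar>e\<bar> \<ge> \<bar>d (l + 1) b\<bar>\<close> because \<open>\<bar>c\<bar> \<ge> 2\<close>.
\<close>

text \<open>
  The characteristic roots of the recursion at \<open>x = q + 1 / q\<close> are \<open>q\<close> and \<open>1 / q\<close>, so growth by
  the factor \<open>q\<close> is to be expected; it propagates because \<open>d k x \<le> d (k + 1) x / q\<close> uses up only
  the summand \<open>1 / q\<close> of \<open>x\<close>.
\<close>

lemma d_growth: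
  assumes "q > 0" and "x \<ge> q + 1 / q"
  shows "0 \<le> d k x \<and> q * d k x \<le> d (Suc k) x"
proof (induction k)
  case (Suc k)
  then have nonneg: "0 \<le> d (Suc k) x"
    using assms(1) by (meson mult_nonneg_nonneg less_imp_le order_trans)
  have "d k x \<le> 1 / q * d (Suc k) x"
    using Suc assms(1) by (simp add: field_simps)
  moreover have "(q + 1 / q) * d (Suc k) x \<le> x * d (Suc k) x"
    using assms(2) nonneg by (rule mult_right_mono)
  ultimately have "q * d (Suc k) x \<le> d (Suc (Suc k)) x"
    by (simp only: d.simps distrib_right)
  with nonneg show ?case ..
qed simp

lemma d_mono_Suc:
  assumes "x \<ge> 2"
  shows "0 \<le> d k x" and "d k x \<le> d (Suc k) x"
  using d_growth[of 1 x k] assms by simp_all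

lemma d_ge_1:
  assumes "x \<ge> 2"
  shows "d (Suc k) x \<ge> 1"
proof (induction k)
  case (Suc k)
  then show ?case
    using d_mono_Suc(2)[OF assms, of "Suc k"] by linarith
qed simp

lemma d_minus: "d k (- x) = (- 1) ^ Suc k * d k x"
  by (induction k x rule: d.induct) (simp_all add: algebra_simps)

text \<open>The parity of \<open>d k\<close> reduces moduli to values at positive arguments.\<close>

lemma abs_d:
  assumes "\<bar>x\<bar> \<ge> 2"
  shows "\<bar>d k x\<bar> = d k \<bar>x\<bar>"
proof -
  have "\<bar>d k x\<bar> = \<bar>d k \<bar>x\<bar>\<bar>"
    using d_minus[of k x] by (cases "x \<ge> 0") (simp_all add: abs_mult power_abs)
  then show ?thesis
    using d_mono_Suc(1)[OF assms] by simp
qed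

text \<open>
  As functions of \<open>x\<close>, both values have the same parity, hence the same sign, and the one of
  larger index dominates; so subtracting the other can only reduce the modulus.
\<close>

lemma abs_d_diff_le:
  assumes "\<bar>x\<bar> \<ge> 2"
  shows "\<bar>d (Suc (Suc k)) x - d k x\<bar> \<le> \<bar>d (Suc (Suc k)) x\<bar>"
proof -
  have "d (Suc (Suc k)) (- x) - d k (- x) = (- 1) ^ Suc k * (d (Suc (Suc k)) x - d k x)"
    by (simp only: d_minus) (simp add: algebra_simps)
  then have "\<bar>d (Suc (Suc k)) x - d k x\<bar> = \<bar>d (Suc (Suc k)) \<bar>x\<bar> - d k \<bar>x\<bar>\<bar>"
    by (cases "x \<ge> 0") (simp_all add: abs_mult power_abs del: d.simps)
  moreover have "0 \<le> d k \<bar>x\<bar>" "d k \<bar>x\<bar> \<le> d (Suc (Suc k)) \<bar>x\<bar>"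
    using d_mono_Suc[OF assms] order_trans by blast+
  ultimately show ?thesis
    unfolding abs_d[OF assms] by linarith
qed

text \<open>
  One step of the recursion preserves the growth condition; here \<open>k\<close> stands for \<open>l - 1\<close>.
\<close>

lemma trace_growth_step:
  fixes a b c e :: real
  assumes a: "\<bar>a\<bar> \<ge> 2" and b: "\<bar>b\<bar> \<ge> 5 / 2"
    and c: "\<bar>c\<bar> \<ge> 2" "\<bar>c\<bar> \<ge> \<bar>d (Suc (Suc k)) a\<bar>"
    and e: "e = d (Suc k) b * (c * b - d (Suc (Suc k)) a + d k a) - c * d k b"
  shows "\<bar>e\<bar> \<ge> \<bar>c\<bar>" and "\<bar>e\<bar> \<ge> \<bar>d (Suc (Suc k)) b\<bar>"
proof -
  define D where "D = \<bar>d (Suc k) b\<bar>"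
  define D' where "D' = \<bar>d (Suc (Suc k)) b\<bar>"
  define \<delta> where "\<delta> = d (Suc (Suc k)) a - d k a"
  have D: "D = d (Suc k) \<bar>b\<bar>" and D': "D' = d (Suc (Suc k)) \<bar>b\<bar>"
    unfolding D_def D'_def using b by (intro abs_d; simp)+
  have "D \<ge> 1"
    unfolding D using b by (intro d_ge_1) simp
  \<comment> \<open>The doubling is growth with \<open>q = 2\<close>, where \<open>q + 1 / q = 5 / 2\<close>.\<close>
  have "2 * D \<le> D'"
    unfolding D D' using d_growth[of 2 "\<bar>b\<bar>" "Suc k"] b by simp
  have "\<bar>\<delta>\<bar> \<le> \<bar>c\<bar>"
    unfolding \<delta>_def using abs_d_diff_le[OF a, of k] c(2) by linarith
  then have "\<bar>d (Suc k) b * \<delta>\<bar> \<le> \<bar>c\<bar> * D"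
    unfolding D_def abs_mult by (subst mult.commute) (rule mult_right_mono, simp_all)
  moreover have "\<bar>c * d (Suc (Suc k)) b\<bar> = \<bar>c\<bar> * D'"
    by (simp only: D'_def abs_mult)
  moreover have "e = c * d (Suc (Suc k)) b - d (Suc k) b * \<delta>"
    unfolding e \<delta>_def by (simp add: algebra_simps)
  ultimately have e_ge: "\<bar>e\<bar> \<ge> \<bar>c\<bar> * (D' - D)"
    by (simp only: right_diff_distrib)
  have "\<bar>c\<bar> * 1 \<le> \<bar>c\<bar> * (D' - D)"
    using \<open>D \<ge> 1\<close> \<open>2 * D \<le> D'\<close> by (intro mult_left_mono) simp_all
  with e_ge show "\<bar>e\<bar> \<ge> \<bar>c\<bar>"
    by simp
  have "2 * (D' / 2) \<le> \<bar>c\<bar> * (D' - D)"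
    using c(1) \<open>D \<ge> 1\<close> \<open>2 * D \<le> D'\<close> by (intro mult_mono) simp_all
  with e_ge show "\<bar>e\<bar> \<ge> \<bar>d (Suc (Suc k)) b\<bar>"
    by (simp add: D'_def)
qed

theorem theorem3p11:
  fixes T0 T1 :: "real \<Rightarrow> real^2^2" and l N :: nat and \<omega> :: real
  defines "x \<equiv> \<lambda>n. transfer_trace T0 T1 1 l n \<omega>"
  assumes "l \<ge> 1"
    and "\<And>\<nu>. det (T0 \<nu>) = 1" and "\<And>\<nu>. det (T1 \<nu>) = 1"
    and "\<bar>x N\<bar> > 2"
    and "\<bar>x (N + 1)\<bar> \<ge> 5 / 2"
    and "\<bar>x (N + 2)\<bar> \<ge> max \<bar>x (N + 1)\<bar> \<bar>d (l + 1) (x N)\<bar>"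
  shows "(\<forall>n\<ge>N. \<bar>x n\<bar> > 2) \<and> \<omega> \<in> super_band_gap T0 T1 1 l N"
proof -
  obtain k where l: "l = Suc k"
    using \<open>l \<ge> 1\<close> by (cases l) auto
  have rec: "x (Suc (Suc (Suc n))) =
      d (Suc k) (x (Suc n)) * (x (Suc (Suc n)) * x (Suc n) - d (Suc (Suc k)) (x n) + d k (x n))
      - x (Suc (Suc n)) * d k (x (Suc n))" for n
    using transfer_trace_recursion[of l T0 \<omega> T1 "Suc (Suc n)"] assms(2-4)
    by (simp add: x_def l del: d.simps)
  have growth: "\<bar>x (N + i)\<bar> > 2 \<and> \<bar>x (Suc (N + i))\<bar> \<ge> 5 / 2 \<and>
      \<bar>x (Suc (Suc (N + i)))\<bar> \<ge> \<bar>x (Suc (N + i))\<bar> \<and>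
      \<bar>x (Suc (Suc (N + i)))\<bar> \<ge> \<bar>d (Suc (Suc k)) (x (N + i))\<bar>" for i
  proof (induction i)
    case 0
    show ?case
      using assms(5-7) by (simp add: l del: d.simps)
  next
    case (Suc i)
    have "\<bar>x (Suc (Suc (Suc (N + i))))\<bar> \<ge> \<bar>x (Suc (Suc (N + i)))\<bar>"
      and "\<bar>x (Suc (Suc (Suc (N + i))))\<bar> \<ge> \<bar>d (Suc (Suc k)) (x (Suc (N + i)))\<bar>"
      using Suc by (intro trace_growth_step[OF _ _ _ _ rec]; linarith)+
    then show ?case
      using Suc by (simp del: d.simps)
  qed
  have "\<bar>x n\<bar> > 2" if "n \<ge> N" for n
    using growth[of "n - N"] that by simp
  then show ?thesis
    by (simp add: super_band_gap_def x_def)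
qed

end
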